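(* Let $K$ be a field of characteristic $p\neq 2,3$ and let $A=(A,\cdot)$ be an assosymmetric algebra over $K$. For $a,b,c\in A$ set $$D(a,b,c)=[([a,b]\star[a,b])\star[a,b],\,c],$$ $$shest(a,b,c)=-3\langle a,c,b\rangle\star\bigl(\langle a,a,b^2\rangle-\langle a,a,b\rangle\star b\bigr)-2\langle a,\langle a,\langle a,c,b\rangle,b\rangle,b\rangle .$$ Then $D(a,b,c)=shest(a,b,c)$ for all $a,b,c\in A$. In particular, $D(a,b,c)$ is a Jordan element of the assosymmetric algebra generated by $a,b,c$, i.e. it lies in the subalgebra of $(A,\star)$ generated by $a,b,c$.
   Context: Algebras are vector spaces over $K$ with a bilinear, not necessarily associative, multiplication $\cdot$. Notation: $(a,b,c)=a\cdot(b\cdot c)-(a\cdot b)\cdot c$, $[a,b]=a\cdot b-b\cdot a$, $a\star b=a\cdot b+b\cdot a$, $\langle a,b,c\rangle=a\star(b\star c)-(a\star b)\star c$, $b^2=b\cdot b$. The algebra $A$ is assosymmetric if $(a,b,c)=(b,a,c)$ and $(a,b,c)=(a,c,b)$ for all $a,b,c\in A$. *)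

theory Defs
  imports Complex_Main
begin

text \<open>
  A not necessarily associative algebra over a field is a vector space, given by its scalar
  multiplication \<open>scale\<close>, with a bilinear product \<open>mul\<close>. No unit is assumed.
\<close>

locale nonassoc_algebra = vector_space scale
  for scale :: "'k::field \<Rightarrow> 'a::ab_group_add \<Rightarrow> 'a" +
  fixes mul :: "'a \<Rightarrow> 'a \<Rightarrow> 'a"
  assumes linear_mul_right: "Vector_Spaces.linear scale scale (\<lambda>y. mul x y)"
    and linear_mul_left: "Vector_Spaces.linear scale scale (\<lambda>x. mul x y)"

text \<open>Sign convention: right-nested product minus left-nested product.\<close>

definition associator :: "('a \<Rightarrow> 'a \<Rightarrow> 'a) \<Rightarrow> 'a \<Rightarrow> 'a \<Rightarrow> 'a \<Rightarrow> 'a::ab_group_add" where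
  "associator mul a b c = mul a (mul b c) - mul (mul a b) c"

definition commutator :: "('a \<Rightarrow> 'a \<Rightarrow> 'a) \<Rightarrow> 'a \<Rightarrow> 'a \<Rightarrow> 'a::ab_group_add" where
  "commutator mul a b = mul a b - mul b a"

text \<open>The Jordan product, without the factor 1/2.\<close>

definition star :: "('a \<Rightarrow> 'a \<Rightarrow> 'a) \<Rightarrow> 'a \<Rightarrow> 'a \<Rightarrow> 'a::ab_group_add" where
  "star mul a b = mul a b + mul b a"

text \<open>The Jordan associator \<open>\<langle>a,b,c\<rangle>\<close>.\<close>

abbreviation star_associator :: "('a \<Rightarrow> 'a \<Rightarrow> 'a) \<Rightarrow> 'a \<Rightarrow> 'a \<Rightarrow> 'a \<Rightarrow> 'a::ab_group_add" where
  "star_associator mul \<equiv> associator (star mul)"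

locale assosymmetric_algebra = nonassoc_algebra +
  assumes associator_swap_left: "associator mul a b c = associator mul b a c"
    and associator_swap_right: "associator mul a b c = associator mul a c b"

definition subalgebra ::
    "('k::field \<Rightarrow> 'a::ab_group_add \<Rightarrow> 'a) \<Rightarrow> ('a \<Rightarrow> 'a \<Rightarrow> 'a) \<Rightarrow> 'a set \<Rightarrow> bool" where
  "subalgebra scale mul S \<longleftrightarrow>
     module.subspace scale S \<and> (\<forall>x\<in>S. \<forall>y\<in>S. mul x y \<in> S)"

definition generated_subalgebra ::
    "('k::field \<Rightarrow> 'a::ab_group_add \<Rightarrow> 'a) \<Rightarrow> ('a \<Rightarrow> 'a \<Rightarrow> 'a) \<Rightarrow> 'a set \<Rightarrow> 'a set" where
  "generated_subalgebra scale mul X = subalgebra scale mul hull X"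

definition D :: "('a \<Rightarrow> 'a \<Rightarrow> 'a) \<Rightarrow> 'a \<Rightarrow> 'a \<Rightarrow> 'a \<Rightarrow> 'a::ab_group_add" where
  "D mul a b c =
     commutator mul
       (star mul (star mul (commutator mul a b) (commutator mul a b)) (commutator mul a b)) c"

definition shest ::
    "('k::field \<Rightarrow> 'a::ab_group_add \<Rightarrow> 'a) \<Rightarrow> ('a \<Rightarrow> 'a \<Rightarrow> 'a) \<Rightarrow> 'a \<Rightarrow> 'a \<Rightarrow> 'a \<Rightarrow> 'a" where
  "shest scale mul a b c =
     scale (- 3)
       (star mul (star_associator mul a c b)
         (star_associator mul a a (mul b b) - star mul (star_associator mul a a b) b))
     - scale 2
         (star_associator mul a (star_associator mul a (star_associator mul a c b) b) b)"

end

theory Submission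
  imports Defs
begin

text \<open>
  Write \<open>f(x, y, z)\<close> for the associator, which assosymmetry makes symmetric in its arguments.

  Expanding the definitions shows that the Jordan associator is a double commutator:
  \<open>\<langle>a, x, b\<rangle> = [[a, b], x]\<close>, with all associator corrections cancelling. Put \<open>w = [a, b]\<close>. The
  triple Jordan associator in \<open>shest\<close> is then \<open>[w, [w, [w, c]]]\<close>, and the identity to be shown
  compares it with \<open>[(w \<star> w) \<star> w, c]\<close> and the product of \<open>[w, c]\<close> with
  \<open>\<langle>a, a, b\<^sup>2\<rangle> - \<langle>a, a, b\<rangle> \<star> b\<close>.

  Two structural facts, in the spirit of Kleinfeld's study of assosymmetric rings, reduce it to
  an associative calculation.

  \<^item> Commutators lie in the nucleus, \<open>f([a, b], x, y) = 0\<close> (\<open>associator_commutator\<close>). So \<open>w\<close>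
    associates with everything, and \<open>\<langle>a, a, b\<^sup>2\<rangle> - \<langle>a, a, b\<rangle> \<star> b\<close> evaluates to
    \<open>[f(a, b, b), a] - 2 w\<^sup>2\<close> (\<open>star_associator_square\<close>).
  \<^item> Commutators annihilate associators, \<open>[a, b] f(x, y, z) = 0 = f(x, y, z) [a, b]\<close>
    (\<open>commutator_mul_associator\<close> and its mirror image). So the nonassociative remainder
    \<open>[f(a, b, b), a]\<close> disappears after multiplication by the commutator \<open>[w, c]\<close>.

  What is left is \<open>4 [w\<^sup>3, c] = 6 [w, c] \<star> w\<^sup>2 - 2 [w, [w, [w, c]]]\<close>, which holds for any \<open>w\<close> in
  the nucleus (\<open>nuclear_cube_commutator\<close>).

  Both structural facts come from linear algebra over the permutations of the letters in an
  identity: for the first, the Teichmueller identity, with division by 2; for the second, the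
  derivation rule for \<open>[ab, x]\<close>, with division by 2 and 3.
  Finally \<open>shest\<close> is written in terms of \<open>\<star>\<close> except for \<open>b\<^sup>2\<close>, which is half of \<open>b \<star> b\<close>;
  hence \<open>D\<close> is a Jordan element.
\<close>

section \<open>Identities of associators and commutators\<close>

context nonassoc_algebra
begin

notation mul (infixl "\<cdot>" 70)

abbreviation asc :: "'a \<Rightarrow> 'a \<Rightarrow> 'a \<Rightarrow> 'a" where "asc \<equiv> associator mul"
abbreviation com :: "'a \<Rightarrow> 'a \<Rightarrow> 'a" where "com \<equiv> commutator mul"

lemma mul_linear_simps:
  "x \<cdot> (y + z) = x \<cdot> y + x \<cdot> z" "(x + y) \<cdot> z = x \<cdot> z + y \<cdot> z"
  "x \<cdot> (y - z) = x \<cdot> y - x \<cdot> z" "(x - y) \<cdot> z = x \<cdot> z - y \<cdot> z"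
  "x \<cdot> (- y) = - (x \<cdot> y)" "(- x) \<cdot> y = - (x \<cdot> y)"
  "x \<cdot> 0 = 0" "0 \<cdot> x = 0"
proof -
  interpret R: Vector_Spaces.linear scale scale "\<lambda>y. x \<cdot> y" for x by (rule linear_mul_right)
  interpret L: Vector_Spaces.linear scale scale "\<lambda>x. x \<cdot> y" for y by (rule linear_mul_left)
  show "x \<cdot> (y + z) = x \<cdot> y + x \<cdot> z" "(x + y) \<cdot> z = x \<cdot> z + y \<cdot> z"
    "x \<cdot> (y - z) = x \<cdot> y - x \<cdot> z" "(x - y) \<cdot> z = x \<cdot> z - y \<cdot> z"
    "x \<cdot> (- y) = - (x \<cdot> y)" "(- x) \<cdot> y = - (x \<cdot> y)"
    "x \<cdot> 0 = 0" "0 \<cdot> x = 0"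
    by (fact R.add L.add R.diff L.diff R.neg L.neg R.zero L.zero)+
qed

lemma associator_linear_simps:
  "asc (x + y) c d = asc x c d + asc y c d"
  "asc (x - y) c d = asc x c d - asc y c d"
  "asc c (x + y) d = asc c x d + asc c y d"
  "asc c (x - y) d = asc c x d - asc c y d"
  "asc c d (x + y) = asc c d x + asc c d y"
  "asc c d (x - y) = asc c d x - asc c d y"
  by (simp_all add: associator_def mul_linear_simps)

text \<open>
  This holds in every algebra. Once the associator is symmetric, permuting the letters turns it
  into a family of linear relations between few unknowns.
\<close>

lemma teichmueller:
  "asc (a \<cdot> b) c d - asc a (b \<cdot> c) d + asc a b (c \<cdot> d) = a \<cdot> asc b c d + asc a b c \<cdot> d"
  by (simp add: associator_def mul_linear_simps)

text \<open>
  In an associative algebra \<open>x \<mapsto> [x, c]\<close> is a derivation; the associators measure its failure to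
  be one here.
\<close>

lemma commutator_derivation_defect:
  "com (a \<cdot> b) c = a \<cdot> com b c + com a c \<cdot> b - asc a b c + asc a c b - asc c a b"
  by (simp add: associator_def commutator_def mul_linear_simps)

end

context assosymmetric_algebra
begin

text \<open>
  As permutative rewrite rules these two transpositions bring the arguments of an associator
  into a canonical order.
\<close>

lemmas associator_sort = associator_swap_left associator_swap_right

lemma teichmueller_symmetric:
  "asc (a \<cdot> b) c d - asc (b \<cdot> c) a d + asc (c \<cdot> d) a b = a \<cdot> asc b c d + asc a b c \<cdot> d"
  using teichmueller[of a b c d] by (simp add: associator_sort)

text \<open>
  The associative part of \<open>\<langle>a, c, b\<rangle>\<close> is \<open>[[a, b], c]\<close>, as in every special Jordan algebra. The six
  remaining associators occur with signs that add up to zero.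
\<close>

lemma star_associator_eq_commutator: "star_associator mul a c b = com (com a b) c"
proof -
  have "star_associator mul a c b - com (com a b) c =
      (asc a c b - asc c b a) + (asc a b c - asc b a c) + (asc c a b - asc b c a)"
    by (simp add: associator_def commutator_def star_def mul_linear_simps)
  then show ?thesis by (simp add: associator_sort)
qed

text \<open>By symmetry, vanishing in one argument puts \<open>w\<close> in the left, middle and right nucleus.\<close>

lemma associator_nuclear_simps:
  assumes "\<And>x y. asc w x y = 0"
  shows "(w \<cdot> x) \<cdot> y = w \<cdot> (x \<cdot> y)" "(x \<cdot> w) \<cdot> y = x \<cdot> (w \<cdot> y)" "(x \<cdot> y) \<cdot> w = x \<cdot> (y \<cdot> w)"
proof -
  have "asc w x y = 0" "asc x w y = 0" "asc x y w = 0"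
    using assms associator_swap_left[of x w y] associator_swap_right[of x y w] by simp_all
  then show "(w \<cdot> x) \<cdot> y = w \<cdot> (x \<cdot> y)" "(x \<cdot> w) \<cdot> y = x \<cdot> (w \<cdot> y)"
    "(x \<cdot> y) \<cdot> w = x \<cdot> (y \<cdot> w)"
    by (simp_all add: associator_def)
qed

text \<open>
  All products here contain at most one factor other than \<open>w\<close>, so they can be computed as in an
  associative algebra: \<open>[w, [w, [w, c]]] = w\<^sup>3c - 3w\<^sup>2cw + 3wcw\<^sup>2 - cw\<^sup>3\<close>, and
  \<open>[w, c] \<star> w\<^sup>2 = w\<^sup>3c - w\<^sup>2cw + wcw\<^sup>2 - cw\<^sup>3\<close>. The multiple 6 of the latter minus twice the former
  leaves \<open>4 (w\<^sup>3c - cw\<^sup>3)\<close>.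
\<close>

lemma nuclear_cube_commutator:
  fixes w c :: 'b
  assumes "\<And>x y. asc w x y = 0"
  defines "j \<equiv> star mul (com w c) (w \<cdot> w)"
    and "k \<equiv> com w (com w (com w c))"
  shows "com (star mul (star mul w w) w) c = j + j + j + (j + j + j) - (k + k)"
  unfolding j_def k_def
  by (simp add: commutator_def star_def mul_linear_simps associator_nuclear_simps[OF assms(1)]
      algebra_simps)

text \<open>
  Reversing the word \<open>abcd\<close> permutes the terms of the Teichmueller identity up to the order of
  the factors in each product, so the difference of the two versions involves only commutators.
\<close>

lemma alternating_commutator_associators:
  "asc (com a b) c d - asc (com b c) a d + asc (com c d) a b
     = com a (asc b c d) - com d (asc a b c)"
  using arg_cong2[OF teichmueller_symmetric[of a b c d] teichmueller_symmetric[of d c b a],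
      of "(-)"]
  by (simp add: commutator_def associator_linear_simps associator_sort algebra_simps)

end

section \<open>Commutators lie in the nucleus\<close>

locale assosymmetric_algebra_away_from_6 = assosymmetric_algebra scale mul
  for scale :: "'k::field \<Rightarrow> 'a::ab_group_add \<Rightarrow> 'a" and mul :: "'a \<Rightarrow> 'a \<Rightarrow> 'a" +
  assumes char_not_2: "CHAR('k) \<noteq> 2" and char_not_3: "CHAR('k) \<noteq> 3"
begin

lemma two_neq_0: "(2::'k) \<noteq> 0" and three_neq_0: "(3::'k) \<noteq> 0"
proof -
  have dvd: "CHAR('k) dvd n" if "of_nat n = (0::'k)" for n
    using that by (simp add: of_nat_eq_0_iff_char_dvd)
  have le: "CHAR('k) \<noteq> 0 \<and> CHAR('k) \<noteq> 1 \<and> CHAR('k) \<le> n" if "CHAR('k) dvd n" "n > 0" for n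
    using that dvd_imp_le[of "CHAR('k)" n] by auto
  show "(2::'k) \<noteq> 0"
  proof
    assume "(2::'k) = 0"
    then have "CHAR('k) dvd 2" using dvd[of 2] by simp
    with le[of 2] char_not_2 show False by linarith
  qed
  show "(3::'k) \<noteq> 0"
  proof
    assume "(3::'k) = 0"
    then have "CHAR('k) dvd 3" using dvd[of 3] by simp
    with le[of 3] char_not_3 have "CHAR('k) = 2" by linarith
    with char_not_2 show False by simp
  qed
qed

lemma double_eq_0_cancel: "x = 0" if "x + x = 0" for x :: 'a
  using that two_neq_0 scale_left_distrib[of 1 1 x] by simp

lemma triple_eq_0_cancel: "x = 0" if "x + x + x = 0" for x :: 'a
  using that three_neq_0 scale_left_distrib[of 2 1 x] scale_left_distrib[of 1 1 x] by simp

text \<open>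
  For fixed \<open>a, b, c, d\<close>, regard the six values \<open>K\<^sub>x\<^sub>y = f([x, y], \<dots>)\<close> and the four values
  \<open>t\<^sub>x = [x, f(\<dots>)]\<close>, the dots being the remaining letters, as unknowns. By
  \<open>alternating_commutator_associators\<close>, \<open>K\<^sub>a\<^sub>b - K\<^sub>b\<^sub>c + K\<^sub>c\<^sub>d = t\<^sub>a - t\<^sub>d\<close> for every ordering of the letters. These equations
  force \<open>K\<^sub>a\<^sub>d = t\<^sub>d - t\<^sub>a\<close>; substituting this back gives \<open>t\<^sub>a = t\<^sub>d\<close>, and hence \<open>K\<^sub>a\<^sub>d = 0\<close>.
\<close>

lemma associator_commutator: "asc (com a b) c d = 0"
proof -
  let ?t = "\<lambda>a b c d. com a (asc b c d)"
  define e where "e a b c d = asc (com a b) c d - asc (com b c) a d + asc (com c d) a b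
    - (?t a b c d - ?t d a b c)" for a b c d
  have e: "e a b c d = 0" for a b c d
    by (simp add: e_def alternating_commutator_associators)
  have K: "asc (com a d) b c = ?t d a b c - ?t a b c d" for a b c d
  proof -
    let ?x = "asc (com a d) b c - (?t d a b c - ?t a b c d)"
    \<comment> \<open>The first two terms cancel their \<open>t\<close>-parts and give \<open>2 K\<^sub>a\<^sub>d + S\<close> with
      \<open>S = K\<^sub>a\<^sub>b + K\<^sub>a\<^sub>c + K\<^sub>c\<^sub>d + K\<^sub>b\<^sub>d\<close>;
      the last two, which are subtracted, add up to \<open>S - 2 (t\<^sub>a - t\<^sub>d)\<close>.\<close>
    have "?x + ?x = e b d a c - e b a d c - e a b c d - e a c b d"
      by (simp add: e_def commutator_def[of mul a] commutator_def[of mul b]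
          commutator_def[of mul c] commutator_def[of mul d] associator_linear_simps
          associator_sort algebra_simps)
    then have "?x = 0"
      using double_eq_0_cancel[of ?x] by (simp only: e) simp
    then show ?thesis by simp
  qed
  have T: "?t a b c d = ?t d a b c" for a b c d
  proof -
    \<comment> \<open>Swapping \<open>b\<close> and \<open>c\<close> changes the sign of \<open>t\<^sub>b - t\<^sub>c\<close> but not of \<open>t\<^sub>a - t\<^sub>d\<close>.\<close>
    let ?y = "\<lambda>b c. ?t b a c d - ?t c a b d - ?t a b c d + ?t d a b c"
    have y: "?y b c = 0" for b c
    proof (rule double_eq_0_cancel)
      show "?y b c + ?y b c = 0"
        using e[of a b c d] unfolding e_def K by (simp add: associator_sort algebra_simps)
    qed
    have "?t d a b c - ?t a b c d = 0"
    proof (rule double_eq_0_cancel)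
      have "?t d a b c - ?t a b c d + (?t d a b c - ?t a b c d) = ?y b c + ?y c b"
        by (simp add: associator_sort algebra_simps)
      then show "?t d a b c - ?t a b c d + (?t d a b c - ?t a b c d) = 0" by (simp add: y)
    qed
    then show ?thesis by simp
  qed
  show "asc (com a b) c d = 0"
    using K[of a b c d] T[of a c d b] by (simp add: associator_sort)
qed

section \<open>Commutators annihilate associators\<close>

lemma associator_mul_commute: "asc (a \<cdot> b) c d = asc (b \<cdot> a) c d"
  using associator_commutator[of a b c d] by (simp add: commutator_def associator_linear_simps)

text \<open>
  A nuclear element can be moved out of an associator: all but two terms of the Teichmueller
  identity vanish. These lemmas identify left and right multiplication of associators by a
  commutator, so that it suffices to treat the left one.
\<close>

lemma commutator_mul_associator_eq: "com a b \<cdot> asc x c d = asc (com a b \<cdot> x) c d"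
  and associator_mul_commutator_eq: "asc x c d \<cdot> com a b = asc (com a b \<cdot> x) c d"
proof -
  have "asc u (com a b) v = 0" "asc u v (com a b) = 0" for u v
    using associator_commutator[of a b] associator_swap_left[of u "com a b"]
      associator_swap_right[of u v "com a b"] by simp_all
  note 0 = associator_commutator this
  have rotate: "asc c d u = asc u c d" for u
    by (simp add: associator_sort)
  show "com a b \<cdot> asc x c d = asc (com a b \<cdot> x) c d"
    using teichmueller_symmetric[of "com a b" x c d] by (simp add: 0 mul_linear_simps)
  have "asc (x \<cdot> com a b) c d = asc c d x \<cdot> com a b"
    using teichmueller_symmetric[of c d x "com a b"] by (simp add: 0 mul_linear_simps)
  then show "asc x c d \<cdot> com a b = asc (com a b \<cdot> x) c d"
    by (simp only: rotate associator_mul_commute[of x])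
qed

text \<open>
  The commutator \<open>[ab, x]\<close> is nuclear; expanding it by the derivation rule gives the
  nested associator as its defect.
\<close>

lemma associator_associator_expand:
  "asc (asc a b x) c d = com b x \<cdot> asc a c d + com a x \<cdot> asc b c d"
proof -
  have "0 = asc (com (a \<cdot> b) x) c d" by (simp add: associator_commutator)
  also have "\<dots> = asc (a \<cdot> com b x) c d + asc (com a x \<cdot> b) c d - asc (asc a b x) c d"
    by (simp add: commutator_derivation_defect associator_linear_simps associator_sort)
  finally show ?thesis
    by (simp add: commutator_mul_associator_eq associator_mul_commute[of a] algebra_simps)
qed

lemma commutator_mul_antisym: "com b a \<cdot> z = - (com a b \<cdot> z)"
  by (simp add: commutator_def mul_linear_simps)

text \<open>
  The left-hand side of \<open>associator_associator_expand\<close> is symmetric in \<open>a, b, x\<close>, while the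
  right-hand side sums to zero over the three choices of the letter in the role of \<open>x\<close>. This is
  where division by 3 enters.
\<close>

lemma associator_associator: "asc (asc a b x) c d = 0"
proof (rule triple_eq_0_cancel)
  have "asc (asc a b x) c d + asc (asc a b x) c d + asc (asc a b x) c d
      = asc (asc a b x) c d + asc (asc a x b) c d + asc (asc b x a) c d"
    by (simp add: associator_sort)
  also have "\<dots> = 0"
    by (simp add: associator_associator_expand commutator_mul_antisym[of x]
        commutator_mul_antisym[of b a])
  finally show "asc (asc a b x) c d + asc (asc a b x) c d + asc (asc a b x) c d = 0" .
qed

text \<open>
  Since nested associators vanish, \<open>associator_associator_expand\<close> says that
  \<open>[a, b] f(x, c, d)\<close> changes sign under the transposition of \<open>b\<close> and \<open>x\<close>,
  whereas it is invariant under that of \<open>x\<close> and \<open>c\<close>. These two transpositions are conjugate in the symmetric group, so the expression equals its negative.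
\<close>

lemma commutator_mul_associator: "com a b \<cdot> asc x c d = 0"
proof (rule double_eq_0_cancel)
  have swap: "com a b \<cdot> asc x c d = - (com a x \<cdot> asc b c d)" for a b x c d
  proof -
    have "com b a \<cdot> asc x c d + com x a \<cdot> asc b c d = 0"
      using associator_associator_expand[of x b a c d] by (simp add: associator_associator)
    then show ?thesis
      by (simp add: commutator_mul_antisym[of _ a]) (metis minus_minus)
  qed
  have "com a b \<cdot> asc x c d = com a b \<cdot> asc c x d" by (simp add: associator_sort)
  also have "\<dots> = - (com a c \<cdot> asc b x d)" by (rule swap)
  also have "\<dots> = - (com a c \<cdot> asc x b d)" by (simp add: associator_sort)
  also have "\<dots> = com a x \<cdot> asc c b d" by (simp add: swap[of a c x])
  also have "\<dots> = com a x \<cdot> asc b c d" by (simp add: associator_sort)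
  also have "\<dots> = - (com a b \<cdot> asc x c d)" by (rule swap)
  finally show "com a b \<cdot> asc x c d + com a b \<cdot> asc x c d = 0"
    by (simp add: eq_neg_iff_add_eq_0)
qed

lemma associator_mul_commutator: "asc x c d \<cdot> com a b = 0"
  using commutator_mul_associator
  by (simp add: associator_mul_commutator_eq commutator_mul_associator_eq)

section \<open>The identity\<close>

text \<open>
  The nuclear factor \<open>[x, y]\<close> can be brought next to the associator in each of the four products.
  Where \<open>a\<close> stands in between, moving past it costs the commutator \<open>[[x, y], a]\<close>, which itself
  annihilates the associator.
\<close>

lemma star_commutators_associator_eq_0: "star mul (com x y) (com (asc u v z) a) = 0"
proof -
  let ?n = "com x y" and ?f = "asc u v z"
  note nuc = associator_nuclear_simps[OF associator_commutator]
  have 1: "?n \<cdot> (?f \<cdot> a) = 0"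
    by (simp flip: nuc add: commutator_mul_associator mul_linear_simps)
  have "?n \<cdot> (a \<cdot> ?f) = com ?n a \<cdot> ?f + a \<cdot> (?n \<cdot> ?f)"
    by (simp add: commutator_def[of mul "com x y"] mul_linear_simps nuc)
  then have 2: "?n \<cdot> (a \<cdot> ?f) = 0"
    by (simp add: commutator_mul_associator mul_linear_simps)
  have "(?f \<cdot> a) \<cdot> ?n = ?f \<cdot> com a ?n + (?f \<cdot> ?n) \<cdot> a"
    by (simp add: commutator_def[of mul a] mul_linear_simps nuc)
  then have 3: "(?f \<cdot> a) \<cdot> ?n = 0"
    by (simp add: associator_mul_commutator mul_linear_simps)
  have 4: "(a \<cdot> ?f) \<cdot> ?n = 0"
    by (simp add: nuc associator_mul_commutator mul_linear_simps)
  show ?thesis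
    by (simp add: star_def commutator_def[of mul ?f] mul_linear_simps 1 2 3 4)
qed

text \<open>
  With \<open>w = [a, b]\<close>, the map \<open>[a, _]\<close> sends \<open>b\<^sup>2\<close> to \<open>w \<star> b + f(a, b, b)\<close>. Applying \<open>[_, a]\<close>
  differentiates the product \<open>w \<star> b\<close>: one term is \<open>[w, a] \<star> b\<close>, the other is
  \<open>w \<star> [b, a] = - 2 w\<^sup>2\<close>.
\<close>

lemma star_associator_square:
  "star_associator mul a a (b \<cdot> b) - star mul (star_associator mul a a b) b
     = com (asc a b b) a - (com a b \<cdot> com a b + com a b \<cdot> com a b)"
proof -
  define w where "w = com a b"
  have nuc: "(w \<cdot> x) \<cdot> y = w \<cdot> (x \<cdot> y)" "(x \<cdot> w) \<cdot> y = x \<cdot> (w \<cdot> y)"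
    "(x \<cdot> y) \<cdot> w = x \<cdot> (y \<cdot> w)" for x y
    unfolding w_def by (rule associator_nuclear_simps[OF associator_commutator])+
  have "com a (b \<cdot> b) - star mul w b = asc a b b + (asc b b a - asc b a b)"
    by (simp add: w_def commutator_def star_def associator_def mul_linear_simps)
  then have "com a (b \<cdot> b) = star mul w b + asc a b b"
    by (simp add: associator_sort algebra_simps)
  then have "star_associator mul a a (b \<cdot> b) - star mul (star_associator mul a a b) b
      = com (asc a b b) a + (com (star mul w b) a - star mul (com w a) b)"
    by (simp add: star_associator_eq_commutator w_def[symmetric])
      (simp add: commutator_def mul_linear_simps)
  moreover have "com (star mul w b) a - star mul (com w a) b = - (w \<cdot> w + w \<cdot> w)"
  proof -
    \<comment> \<open>The two copies of \<open>w\<^sup>2\<close> appear expanded in different factors.\<close>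
    have "w \<cdot> w = w \<cdot> (a \<cdot> b) - w \<cdot> (b \<cdot> a)"
      by (simp add: w_def commutator_def[of mul a b] mul_linear_simps)
    moreover have "w \<cdot> w = a \<cdot> (b \<cdot> w) - b \<cdot> (a \<cdot> w)"
    proof -
      have "w \<cdot> w = (a \<cdot> b) \<cdot> w - (b \<cdot> a) \<cdot> w"
        by (simp add: w_def commutator_def[of mul a b] mul_linear_simps)
      then show ?thesis by (simp only: nuc)
    qed
    moreover have "com (star mul w b) a - star mul (com w a) b
        = - (w \<cdot> (a \<cdot> b) - w \<cdot> (b \<cdot> a) + (a \<cdot> (b \<cdot> w) - b \<cdot> (a \<cdot> w)))"
      by (simp add: commutator_def star_def mul_linear_simps nuc algebra_simps)
    ultimately show ?thesis by simp
  qed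
  ultimately show ?thesis by (simp add: w_def)
qed

theorem D_eq_shest: "D mul a b c = shest scale mul a b c"
proof -
  define w where "w = com a b"
  have s3: "scale 3 x = x + x + x" and s2: "scale 2 x = x + x" for x
    using scale_left_distrib[of 1 1 x] scale_left_distrib[of 2 1 x] by simp_all
  have "shest scale mul a b c
      = scale (- 3) (star mul (com w c) (com (asc a b b) a - (w \<cdot> w + w \<cdot> w)))
        - scale 2 (com w (com w (com w c)))"
    by (simp add: shest_def star_associator_square)
      (simp add: star_associator_eq_commutator w_def)
  also have "star mul (com w c) (com (asc a b b) a - (w \<cdot> w + w \<cdot> w))
      = - (star mul (com w c) (w \<cdot> w) + star mul (com w c) (w \<cdot> w))"
    using star_commutators_associator_eq_0[of w c a b b a]
    by (simp add: star_def mul_linear_simps algebra_simps)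
  finally show ?thesis
    using nuclear_cube_commutator[of w c]
    by (simp add: s3 s2 D_def w_def associator_commutator)
qed

lemma shest_in_generated_subalgebra:
  "shest scale mul a b c \<in> generated_subalgebra scale (star mul) {a, b, c}"
  unfolding generated_subalgebra_def hull_def
proof (intro InterI, elim CollectE conjE)
  fix S assume S: "subalgebra scale (star mul) S" and "{a, b, c} \<subseteq> S"
  then have abc: "a \<in> S" "b \<in> S" "c \<in> S" by auto
  have star: "star mul x y \<in> S" if "x \<in> S" "y \<in> S" for x y
    using S that by (simp add: subalgebra_def)
  have sub: "subspace S" using S by (simp add: subalgebra_def)
  have assoc: "star_associator mul x y z \<in> S" if "x \<in> S" "y \<in> S" "z \<in> S" for x y z
    using that by (simp add: associator_def star subspace_diff[OF sub])
  have "scale 2 (b \<cdot> b) = star mul b b"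
    using scale_left_distrib[of 1 1 "b \<cdot> b"] by (simp add: star_def)
  then have "b \<cdot> b = scale (1 / 2) (star mul b b)"
    using two_neq_0 by (metis scale_scale scale_one nonzero_divide_eq_eq)
  then have square: "b \<cdot> b \<in> S"
    using star[OF abc(2) abc(2)] by (simp add: subspace_scale[OF sub])
  show "shest scale mul a b c \<in> S"
    unfolding shest_def
    by (intro subspace_diff[OF sub] subspace_scale[OF sub] star assoc abc square)
qed

end

theorem lemma1p6:
  fixes scale :: "'k::field \<Rightarrow> 'a::ab_group_add \<Rightarrow> 'a"
    and mul :: "'a \<Rightarrow> 'a \<Rightarrow> 'a"
  assumes "CHAR('k) \<noteq> 2" and "CHAR('k) \<noteq> 3"
    and "assosymmetric_algebra scale mul"
  shows "\<forall>a b c. D mul a b c = shest scale mul a b c \<and>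
                 D mul a b c \<in> generated_subalgebra scale (star mul) {a, b, c}"
proof -
  interpret assosymmetric_algebra_away_from_6 scale mul
    using assms
    by (intro assosymmetric_algebra_away_from_6.intro assosymmetric_algebra_away_from_6_axioms.intro)
  show ?thesis
    using D_eq_shest shest_in_generated_subalgebra by simp
qed

end
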